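(* Every existentially closed co-Brouwerian semilattice $L$ satisfies the Density 2 Axiom: for all $c,a_1,a_2,d\in L$ such that $a_1,a_2\neq0$, $c\ll a_1$, $c\ll a_2$, $a_1-d=a_1$ and $a_2-d=a_2$, there exists $b\in L$, $b\neq 0$, such that $c\ll b$, $b\ll a_1$, $b\ll a_2$ and $b-d=b$.
   Context: A co-Brouwerian semilattice (CBS) is a poset with least element $0$, binary joins $\vee$ and a difference $-$ characterized by $a-b\le c$ iff $a\le b\vee c$. $a\ll b$ means $a\le b$ and $b-a=b$. A CBS $L$ is existentially closed if for every CBS $B\supseteq L$ (superstructure in signature $(0,\vee,-)$), every existential sentence with parameters in $L$ true in $B$ is true in $L$. *)

theory Defs
  imports "HOL-Algebra.Lattice"
begin

section \<open>Co-Brouwerian semilattices\<close>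

text \<open>The least element and the binary joins are those of the underlying order, so \<open>\<bottom>\<close> and
  \<open>\<squnion>\<close> are the operations of HOL-Algebra; only the difference has to be added to the record.
  Like them, it is determined by the order.\<close>

record 'a cbs = "'a gorder" +
  diff :: "['a, 'a] \<Rightarrow> 'a" (infixl \<open>\<setminus>\<index>\<close> 65)

locale co_brouwerian_semilattice =
    upper_semilattice L + weak_partial_order_bottom L for L (structure) +
  assumes diff_closed: "\<lbrakk>a \<in> carrier L; b \<in> carrier L\<rbrakk> \<Longrightarrow> a \<setminus> b \<in> carrier L"
    and diff_le_iff: "\<lbrakk>a \<in> carrier L; b \<in> carrier L; c \<in> carrier L\<rbrakk> \<Longrightarrow>
      a \<setminus> b \<sqsubseteq> c \<longleftrightarrow> a \<sqsubseteq> b \<squnion> c"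

definition well_below :: "'a cbs \<Rightarrow> 'a \<Rightarrow> 'a \<Rightarrow> bool" (infixl \<open>\<lless>\<index>\<close> 50)
  where "a \<lless>\<^bsub>L\<^esub> b \<longleftrightarrow> a \<sqsubseteq>\<^bsub>L\<^esub> b \<and> b \<setminus>\<^bsub>L\<^esub> a = b"

text \<open>A superstructure of \<open>L\<close> is given by an embedding \<open>f\<close> of \<open>L\<close>, which need not be an
  inclusion of carriers.\<close>

definition cbs_embedding :: "'a cbs \<Rightarrow> 'b cbs \<Rightarrow> ('a \<Rightarrow> 'b) \<Rightarrow> bool"
  where "cbs_embedding L B f \<longleftrightarrow>
    f \<in> carrier L \<rightarrow> carrier B \<and> inj_on f (carrier L) \<and>
    f \<bottom>\<^bsub>L\<^esub> = \<bottom>\<^bsub>B\<^esub> \<and>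
    (\<forall>a\<in>carrier L. \<forall>b\<in>carrier L. f (a \<squnion>\<^bsub>L\<^esub> b) = f a \<squnion>\<^bsub>B\<^esub> f b) \<and>
    (\<forall>a\<in>carrier L. \<forall>b\<in>carrier L. f (a \<setminus>\<^bsub>L\<^esub> b) = f a \<setminus>\<^bsub>B\<^esub> f b)"


section \<open>Existential sentences with parameters\<close>

text \<open>Terms in the signature \<open>(0, \<or>, -)\<close> with variables \<open>x\<^sub>0, x\<^sub>1, \<dots>\<close> and parameters in \<open>'a\<close>.\<close>

datatype 'a cbs_term =
    Var nat
  | Param 'a
  | Zero
  | Join "'a cbs_term" "'a cbs_term"
  | Diff "'a cbs_term" "'a cbs_term"

primrec term_vars :: "'a cbs_term \<Rightarrow> nat set" where
  "term_vars (Var i) = {i}"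
| "term_vars (Param a) = {}"
| "term_vars Zero = {}"
| "term_vars (Join s t) = term_vars s \<union> term_vars t"
| "term_vars (Diff s t) = term_vars s \<union> term_vars t"

primrec term_params :: "'a cbs_term \<Rightarrow> 'a set" where
  "term_params (Var i) = {}"
| "term_params (Param a) = {a}"
| "term_params Zero = {}"
| "term_params (Join s t) = term_params s \<union> term_params t"
| "term_params (Diff s t) = term_params s \<union> term_params t"

primrec term_val :: "'b cbs \<Rightarrow> ('a \<Rightarrow> 'b) \<Rightarrow> (nat \<Rightarrow> 'b) \<Rightarrow> 'a cbs_term \<Rightarrow> 'b" where
  "term_val B f v (Var i) = v i"
| "term_val B f v (Param a) = f a"
| "term_val B f v Zero = \<bottom>\<^bsub>B\<^esub>"
| "term_val B f v (Join s t) = term_val B f v s \<squnion>\<^bsub>B\<^esub> term_val B f v t"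
| "term_val B f v (Diff s t) = term_val B f v s \<setminus>\<^bsub>B\<^esub> term_val B f v t"

datatype 'a qf_formula =
    Equal "'a cbs_term" "'a cbs_term"
  | Neg "'a qf_formula"
  | Conj "'a qf_formula" "'a qf_formula"
  | Disj "'a qf_formula" "'a qf_formula"

primrec qf_vars :: "'a qf_formula \<Rightarrow> nat set" where
  "qf_vars (Equal s t) = term_vars s \<union> term_vars t"
| "qf_vars (Neg p) = qf_vars p"
| "qf_vars (Conj p q) = qf_vars p \<union> qf_vars q"
| "qf_vars (Disj p q) = qf_vars p \<union> qf_vars q"

primrec qf_params :: "'a qf_formula \<Rightarrow> 'a set" where
  "qf_params (Equal s t) = term_params s \<union> term_params t"
| "qf_params (Neg p) = qf_params p"
| "qf_params (Conj p q) = qf_params p \<union> qf_params q"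
| "qf_params (Disj p q) = qf_params p \<union> qf_params q"

primrec qf_holds :: "'b cbs \<Rightarrow> ('a \<Rightarrow> 'b) \<Rightarrow> (nat \<Rightarrow> 'b) \<Rightarrow> 'a qf_formula \<Rightarrow> bool" where
  "qf_holds B f v (Equal s t) \<longleftrightarrow> term_val B f v s = term_val B f v t"
| "qf_holds B f v (Neg p) \<longleftrightarrow> \<not> qf_holds B f v p"
| "qf_holds B f v (Conj p q) \<longleftrightarrow> qf_holds B f v p \<and> qf_holds B f v q"
| "qf_holds B f v (Disj p q) \<longleftrightarrow> qf_holds B f v p \<or> qf_holds B f v q"

text \<open>Truth in \<open>B\<close> of the sentence \<open>\<exists>x\<^sub>0 \<dots> x\<^bsub>n-1\<^esub>. p\<close>, where the parameter \<open>a\<close> denotes \<open>f a\<close>.\<close>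

definition ex_holds :: "'b cbs \<Rightarrow> ('a \<Rightarrow> 'b) \<Rightarrow> nat \<Rightarrow> 'a qf_formula \<Rightarrow> bool"
  where "ex_holds B f n p \<longleftrightarrow> (\<exists>v. (\<forall>i<n. v i \<in> carrier B) \<and> qf_holds B f v p)"


section \<open>Existentially closed co-Brouwerian semilattices\<close>

text \<open>A definition cannot quantify over all types, so the superstructures \<open>B\<close> are taken with
  carrier a set of terms over \<open>L\<close>. This is no restriction, and superstructures over all
  other types are covered as well (downward Loewenheim-Skolem): the substructure generated by
  \<open>L\<close> and the witnesses consists of values of such terms. See
  \<open>existentially_closed_superstructure\<close> below.\<close>

definition existentially_closed :: "'a cbs \<Rightarrow> bool"
  where "existentially_closed L \<longleftrightarrow> co_brouwerian_semilattice L \<and>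
    (\<forall>(B :: 'a cbs_term cbs) f n p.
      co_brouwerian_semilattice B \<and> cbs_embedding L B f \<and>
      qf_vars p \<subseteq> {..<n} \<and> qf_params p \<subseteq> carrier L \<and> ex_holds B f n p
      \<longrightarrow> ex_holds L (\<lambda>a. a) n p)"

lemma (in upper_semilattice) join_eqI:
  assumes "x \<in> carrier L" "y \<in> carrier L" "j \<in> carrier L" "x \<sqsubseteq> j" "y \<sqsubseteq> j"
    and "\<And>z. \<lbrakk>z \<in> carrier L; x \<sqsubseteq> z; y \<sqsubseteq> z\<rbrakk> \<Longrightarrow> j \<sqsubseteq> z"
  shows "x \<squnion> y = j"
  using assms by (meson join_closed join_le join_left join_right le_antisym)

lemma (in co_brouwerian_semilattice) bottom_eqI:
  assumes "z \<in> carrier L" "\<And>x. x \<in> carrier L \<Longrightarrow> z \<sqsubseteq> x"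
  shows "\<bottom> = z"
  using assms by (meson bottom_closed bottom_lower le_antisym)

text \<open>A presentation of a co-Brouwerian semilattice by explicit operations.\<close>

lemma cbs_from_operations:
  assumes "eq B = (=)"
    and refl: "\<And>x. x \<in> carrier B \<Longrightarrow> x \<sqsubseteq>\<^bsub>B\<^esub> x"
    and antisym: "\<And>x y. \<lbrakk>x \<in> carrier B; y \<in> carrier B; x \<sqsubseteq>\<^bsub>B\<^esub> y; y \<sqsubseteq>\<^bsub>B\<^esub> x\<rbrakk> \<Longrightarrow> x = y"
    and trans: "\<And>x y z. \<lbrakk>x \<in> carrier B; y \<in> carrier B; z \<in> carrier B;
      x \<sqsubseteq>\<^bsub>B\<^esub> y; y \<sqsubseteq>\<^bsub>B\<^esub> z\<rbrakk> \<Longrightarrow> x \<sqsubseteq>\<^bsub>B\<^esub> z"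
    and bot: "o' \<in> carrier B" "\<And>x. x \<in> carrier B \<Longrightarrow> o' \<sqsubseteq>\<^bsub>B\<^esub> x"
    and join: "\<And>x y. \<lbrakk>x \<in> carrier B; y \<in> carrier B\<rbrakk> \<Longrightarrow> j x y \<in> carrier B"
      "\<And>x y z. \<lbrakk>x \<in> carrier B; y \<in> carrier B; z \<in> carrier B\<rbrakk> \<Longrightarrow>
        j x y \<sqsubseteq>\<^bsub>B\<^esub> z \<longleftrightarrow> x \<sqsubseteq>\<^bsub>B\<^esub> z \<and> y \<sqsubseteq>\<^bsub>B\<^esub> z"
    and diff: "\<And>x y. \<lbrakk>x \<in> carrier B; y \<in> carrier B\<rbrakk> \<Longrightarrow> x \<setminus>\<^bsub>B\<^esub> y \<in> carrier B"
      "\<And>x y z. \<lbrakk>x \<in> carrier B; y \<in> carrier B; z \<in> carrier B\<rbrakk> \<Longrightarrow>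
        x \<setminus>\<^bsub>B\<^esub> y \<sqsubseteq>\<^bsub>B\<^esub> z \<longleftrightarrow> x \<sqsubseteq>\<^bsub>B\<^esub> j y z"
  shows "co_brouwerian_semilattice B"
    and "\<bottom>\<^bsub>B\<^esub> = o'"
    and "\<And>x y. \<lbrakk>x \<in> carrier B; y \<in> carrier B\<rbrakk> \<Longrightarrow> x \<squnion>\<^bsub>B\<^esub> y = j x y"
proof -
  have po: "partial_order B"
    by unfold_locales (use assms(1) refl antisym in \<open>auto intro: trans\<close>)
  have us: "upper_semilattice B"
  proof (intro upper_semilattice.intro po upper_semilattice_axioms.intro)
    fix x y assume xy: "x \<in> carrier B" "y \<in> carrier B"
    then have "least B (j x y) (Upper B {x, y})"
      using join refl[OF join(1)[OF xy]] unfolding least_def Upper_def by auto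
    then show "\<exists>s. least B s (Upper B {x, y})" ..
  qed
  interpret us: upper_semilattice B by (rule us)
  show join': "x \<squnion>\<^bsub>B\<^esub> y = j x y" if "x \<in> carrier B" "y \<in> carrier B" for x y
  proof (rule us.join_eqI)
    have *: "j x y \<sqsubseteq>\<^bsub>B\<^esub> z \<longleftrightarrow> x \<sqsubseteq>\<^bsub>B\<^esub> z \<and> y \<sqsubseteq>\<^bsub>B\<^esub> z" if "z \<in> carrier B" for z
      using join(2) that \<open>x \<in> carrier B\<close> \<open>y \<in> carrier B\<close> by simp
    show "x \<in> carrier B" "y \<in> carrier B" by (fact that)+
    show jxy: "j x y \<in> carrier B" by (rule join(1)) (fact that)+
    have "x \<sqsubseteq>\<^bsub>B\<^esub> j x y \<and> y \<sqsubseteq>\<^bsub>B\<^esub> j x y"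
      using *[OF jxy] refl[OF jxy] by (rule iffD1)
    then show "x \<sqsubseteq>\<^bsub>B\<^esub> j x y" "y \<sqsubseteq>\<^bsub>B\<^esub> j x y" by simp_all
    show "j x y \<sqsubseteq>\<^bsub>B\<^esub> z" if "z \<in> carrier B" "x \<sqsubseteq>\<^bsub>B\<^esub> z" "y \<sqsubseteq>\<^bsub>B\<^esub> z" for z
      using *[OF that(1)] that(2,3) by simp
  qed
  show cbs: "co_brouwerian_semilattice B"
  proof (intro co_brouwerian_semilattice.intro us weak_partial_order_bottom.intro
      us.weak_partial_order_axioms weak_partial_order_bottom_axioms.intro
      co_brouwerian_semilattice_axioms.intro)
    show "\<exists>x. least B x (carrier B)"
      using bot unfolding least_def by auto
  qed (simp_all add: diff join')
  show "\<bottom>\<^bsub>B\<^esub> = o'"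
    by (rule co_brouwerian_semilattice.bottom_eqI[OF cbs bot])
qed

theorem existentially_closed_superstructure:
  fixes L :: "'a cbs" and B :: "'b cbs"
  assumes ec: "existentially_closed L"
    and B: "co_brouwerian_semilattice B" and f: "cbs_embedding L B f"
    and p: "qf_vars p \<subseteq> {..<n}" "qf_params p \<subseteq> carrier L"
    and holds: "ex_holds B f n p"
  shows "ex_holds L (\<lambda>a. a) n p"
proof -
  interpret L: co_brouwerian_semilattice L
    using ec by (simp add: existentially_closed_def)
  interpret B: co_brouwerian_semilattice B by (rule B)
  obtain w where w: "\<forall>i<n. w i \<in> carrier B" "qf_holds B f w p"
    using holds by (auto simp: ex_holds_def)
  define v where "v i = (if i < n then w i else \<bottom>\<^bsub>B\<^esub>)" for i
  have v: "v i \<in> carrier B" for i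
    using w by (auto simp: v_def)
  have ft: "f a \<in> carrier B" if "a \<in> carrier L" for a
    using f that by (auto simp: cbs_embedding_def)
  define T where "T = {t. term_params t \<subseteq> carrier L}"
  define ev where "ev = term_val B f v"
  have evT: "ev t \<in> carrier B" if "t \<in> T" for t
    using that by (induction t) (auto simp: ev_def T_def v ft B.diff_closed)
  define S where "S = ev ` T"
  have S_sub: "S \<subseteq> carrier B" using evT by (auto simp: S_def)
  have T_simps: "Var i \<in> T" "Zero \<in> T" "Param a \<in> T \<longleftrightarrow> a \<in> carrier L"
    "Join s t \<in> T \<longleftrightarrow> s \<in> T \<and> t \<in> T" "Diff s t \<in> T \<longleftrightarrow> s \<in> T \<and> t \<in> T" for i a s t
    by (auto simp: T_def)
  have S_var: "v i \<in> S" for i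
    using T_simps(1)[of i] unfolding S_def ev_def by (metis image_eqI term_val.simps(1))
  have S_par: "f a \<in> S" if "a \<in> carrier L" for a
    using T_simps(3)[of a] that unfolding S_def ev_def by (metis image_eqI term_val.simps(2))
  have S_bot: "\<bottom>\<^bsub>B\<^esub> \<in> S"
    using T_simps(2) unfolding S_def ev_def by (metis image_eqI term_val.simps(3))
  have S_join: "x \<squnion>\<^bsub>B\<^esub> y \<in> S" if "x \<in> S" "y \<in> S" for x y
    using that T_simps(4) unfolding S_def ev_def by (smt (verit) imageE image_eqI term_val.simps(4))
  have S_diff: "x \<setminus>\<^bsub>B\<^esub> y \<in> S" if "x \<in> S" "y \<in> S" for x y
    using that T_simps(5) unfolding S_def ev_def by (smt (verit) imageE image_eqI term_val.simps(5))
  define g where "g = inv_into T ev"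
  have ev_g[simp]: "ev (g x) = x" if "x \<in> S" for x
    using that by (simp add: S_def g_def f_inv_into_f)
  define C where "C = g ` S"
  have g_C[simp]: "g x \<in> C" if "x \<in> S" for x using that by (simp add: C_def)
  have ev_C[simp]: "ev t \<in> S" if "t \<in> C" for t using that by (auto simp: C_def)
  have ev_B[simp]: "ev t \<in> carrier B" if "t \<in> C" for t using that S_sub by auto
  have g_ev[simp]: "g (ev t) = t" if "t \<in> C" for t using that by (auto simp: C_def)
  define B' :: "'a cbs_term cbs" where
    "B' = \<lparr>carrier = C, eq = (=), le = (\<lambda>x y. ev x \<sqsubseteq>\<^bsub>B\<^esub> ev y), diff = (\<lambda>x y. g (ev x \<setminus>\<^bsub>B\<^esub> ev y))\<rparr>"
  have [simp]: "carrier B' = C" "eq B' = (=)" "(x \<sqsubseteq>\<^bsub>B'\<^esub> y) = (ev x \<sqsubseteq>\<^bsub>B\<^esub> ev y)"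
    "x \<setminus>\<^bsub>B'\<^esub> y = g (ev x \<setminus>\<^bsub>B\<^esub> ev y)" for x y
    by (simp_all add: B'_def)
  let ?j = "\<lambda>x y. g (ev x \<squnion>\<^bsub>B\<^esub> ev y)"
  have *: "\<And>x y. \<lbrakk>x \<in> C; y \<in> C; ev x \<sqsubseteq>\<^bsub>B\<^esub> ev y; ev y \<sqsubseteq>\<^bsub>B\<^esub> ev x\<rbrakk> \<Longrightarrow> x = y"
    by (metis B.le_antisym ev_B g_ev)
  have **: "ev x \<squnion>\<^bsub>B\<^esub> ev y \<sqsubseteq>\<^bsub>B\<^esub> ev z \<longleftrightarrow> ev x \<sqsubseteq>\<^bsub>B\<^esub> ev z \<and> ev y \<sqsubseteq>\<^bsub>B\<^esub> ev z"
    if "x \<in> C" "y \<in> C" "z \<in> C" for x y z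
    using that by (meson B.join_closed B.join_le B.join_left B.join_right B.le_trans ev_B)
  have tr: "\<And>x y z. \<lbrakk>x \<in> C; y \<in> C; z \<in> C; ev x \<sqsubseteq>\<^bsub>B\<^esub> ev y; ev y \<sqsubseteq>\<^bsub>B\<^esub> ev z\<rbrakk> \<Longrightarrow> ev x \<sqsubseteq>\<^bsub>B\<^esub> ev z"
    by (meson B.le_trans ev_B)
  note ops = cbs_from_operations[of B' "g \<bottom>\<^bsub>B\<^esub>" ?j]
  have B': "co_brouwerian_semilattice B'"
    by (rule ops) (auto simp: S_bot S_join S_diff ** B.diff_le_iff intro: * tr)
  have bot': "\<bottom>\<^bsub>B'\<^esub> = g \<bottom>\<^bsub>B\<^esub>"
    by (rule ops) (auto simp: S_bot S_join S_diff ** B.diff_le_iff intro: * tr)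
  have join': "x \<squnion>\<^bsub>B'\<^esub> y = ?j x y" if "x \<in> C" "y \<in> C" for x y
    by (rule ops) (use that in \<open>auto simp: S_bot S_join S_diff ** B.diff_le_iff intro: * tr\<close>)
  have inj_g: "g x = g y \<longleftrightarrow> x = y" if "x \<in> S" "y \<in> S" for x y
    using that by (metis ev_g)
  have emb: "cbs_embedding L B' (\<lambda>a. g (f a))"
    using f S_par unfolding cbs_embedding_def
    by (auto simp: bot' join' inj_on_def inj_g)
  have val: "term_val B' (\<lambda>a. g (f a)) (\<lambda>i. g (v i)) t = g (term_val B f v t) \<and>
      term_val B f v t \<in> S" if "term_params t \<subseteq> carrier L" for t
    using that
    by (induction t) (auto simp: bot' join' S_var S_par S_bot S_join S_diff)
  have v_w: "term_val B f v t = term_val B f w t" if "term_vars t \<subseteq> {..<n}" for t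
    using that by (induction t) (auto simp: v_def)
  have "qf_holds B' (\<lambda>a. g (f a)) (\<lambda>i. g (v i)) q \<longleftrightarrow> qf_holds B f w q"
    if "qf_vars q \<subseteq> {..<n}" "qf_params q \<subseteq> carrier L" for q
    using that
  proof (induction q)
    case (Equal s t)
    then have "term_val B' (\<lambda>a. g (f a)) (\<lambda>i. g (v i)) s = g (term_val B f w s)"
      "term_val B' (\<lambda>a. g (f a)) (\<lambda>i. g (v i)) t = g (term_val B f w t)"
      "term_val B f w s \<in> S" "term_val B f w t \<in> S"
      using val[of s] val[of t] v_w[of s] v_w[of t] by auto
    then show ?case by (simp add: inj_g)
  qed auto
  then have "qf_holds B' (\<lambda>a. g (f a)) (\<lambda>i. g (v i)) p"
    using p w by blast
  then have "ex_holds B' (\<lambda>a. g (f a)) n p"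
    unfolding ex_holds_def by (intro exI[of _ "\<lambda>i. g (v i)"]) (simp add: S_var)
  then show ?thesis
    using ec B' emb p unfolding existentially_closed_def by blast
qed

end

(* The map x |-> {I. x \<notin> I} embeds a co-Brouwerian semilattice into the down-closed sets of ideals:
   no primeness is needed, because x - y \<notin> I holds iff the ideal generated by I and y omits x.
   Now let c, d, a1, a2 be as in the axiom. For every ideal K that contains c and d but neither a1 nor
   a2, add a new point immediately below K whose only other predecessors are the ideals I \<subseteq> K with
   c \<notin> I. In the down-closed sets of the enlarged poset, the new points together with the image of c
   form the required b, and existential closedness pulls b back into L. *)
theory Submission
  imports Defs
begin

section \<open>Order and difference\<close>

context co_brouwerian_semilattice
begin

lemma join_eq_right_iff:
  assumes "a \<in> carrier L" "b \<in> carrier L"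
  shows "a \<squnion> b = b \<longleftrightarrow> a \<sqsubseteq> b"
  using assms by (metis join_eqI join_left le_refl)

lemma le_join_diff:
  assumes "a \<in> carrier L" "b \<in> carrier L"
  shows "a \<sqsubseteq> b \<squnion> (a \<setminus> b)"
  using assms by (simp add: diff_closed flip: diff_le_iff)

lemma diff_le:
  assumes "a \<in> carrier L" "b \<in> carrier L"
  shows "a \<setminus> b \<sqsubseteq> a"
  using assms by (simp add: diff_le_iff join_right)

lemma diff_self:
  assumes "a \<in> carrier L"
  shows "a \<setminus> a = \<bottom>"
  using assms by (intro bottom_eqI[symmetric]) (simp_all add: diff_closed diff_le_iff join_left)

text \<open>With \<open>z\<close> the difference in question, \<open>a\<close> lies below
  \<open>b \<squnion> (c \<squnion> z)\<close>. The adjunction removes \<open>b\<close>, since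
  \<open>a \<setminus> b = a\<close>, and then \<open>c\<close> in the same way, leaving
  \<open>a \<sqsubseteq> z\<close>.\<close>

lemma diff_join_eqI:
  assumes "a \<in> carrier L" "b \<in> carrier L" "c \<in> carrier L" "a \<setminus> b = a" "a \<setminus> c = a"
  shows "a \<setminus> (b \<squnion> c) = a"
proof (rule le_antisym)
  let ?z = "a \<setminus> (b \<squnion> c)"
  have z: "?z \<in> carrier L" using assms by (simp add: diff_closed)
  have "a \<sqsubseteq> b \<squnion> (c \<squnion> ?z)"
    using le_join_diff[of a "b \<squnion> c"] weak_join_assoc[of b c ?z] assms z by (simp add: eq_is_equal)
  then have "a \<sqsubseteq> c \<squnion> ?z"
    using diff_le_iff[of a b "c \<squnion> ?z"] assms z by simp
  then show "a \<sqsubseteq> ?z"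
    using diff_le_iff[of a c ?z] assms z by simp
qed (use assms in \<open>auto simp: diff_closed diff_le\<close>)

end


section \<open>Ideals\<close>

definition cbs_ideal :: "('a, 'm) cbs_scheme \<Rightarrow> 'a set \<Rightarrow> bool"
  where "cbs_ideal L I \<longleftrightarrow> I \<subseteq> carrier L \<and> \<bottom>\<^bsub>L\<^esub> \<in> I \<and>
    (\<forall>x\<in>I. \<forall>y\<in>I. x \<squnion>\<^bsub>L\<^esub> y \<in> I) \<and> (\<forall>x\<in>carrier L. \<forall>y\<in>I. x \<sqsubseteq>\<^bsub>L\<^esub> y \<longrightarrow> x \<in> I)"

text \<open>This is the ideal generated by \<open>I\<close> and \<open>y\<close>, since \<open>x \<sqsubseteq> y \<squnion> i\<close> means \<open>x \<setminus> y \<sqsubseteq> i\<close>.\<close>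

definition ideal_adjoin :: "('a, 'm) cbs_scheme \<Rightarrow> 'a set \<Rightarrow> 'a \<Rightarrow> 'a set"
  where "ideal_adjoin L I y = {x \<in> carrier L. x \<setminus>\<^bsub>L\<^esub> y \<in> I}"

context co_brouwerian_semilattice
begin

lemma cbs_ideal_downD:
  assumes "cbs_ideal L I" "y \<in> I" "x \<in> carrier L" "x \<sqsubseteq> y"
  shows "x \<in> I"
  using assms by (auto simp: cbs_ideal_def)

lemma cbs_ideal_join_iff:
  assumes "cbs_ideal L I" "x \<in> carrier L" "y \<in> carrier L"
  shows "x \<squnion> y \<in> I \<longleftrightarrow> x \<in> I \<and> y \<in> I"
  using assms by (metis cbs_ideal_def join_left join_right)

lemma cbs_ideal_principal:
  assumes "a \<in> carrier L"
  shows "cbs_ideal L {x \<in> carrier L. x \<sqsubseteq> a}"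
  using assms unfolding cbs_ideal_def
  by (auto simp: join_le) (meson le_trans)

lemma cbs_ideal_adjoin:
  assumes I: "cbs_ideal L I" and y: "y \<in> carrier L"
  shows "cbs_ideal L (ideal_adjoin L I y)"
proof -
  \<comment> \<open>All three closure properties reduce to this criterion: it suffices to bound
    \<open>x\<close> by \<open>y\<close> joined with a single element of \<open>I\<close>.\<close>
  have down: "x \<setminus> y \<in> I" if "x \<in> carrier L" "i \<in> I" "x \<sqsubseteq> y \<squnion> i" for x i
    using that I y by (meson cbs_ideal_def cbs_ideal_downD diff_closed diff_le_iff subsetD)
  have "(u \<squnion> v) \<setminus> y \<in> I"
    if uv: "u \<in> carrier L" "u \<setminus> y \<in> I" "v \<in> carrier L" "v \<setminus> y \<in> I" for u v
  proof (rule down)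
    let ?i = "(u \<setminus> y) \<squnion> (v \<setminus> y)"
    show "?i \<in> I" using uv I by (simp add: cbs_ideal_def)
    have "u \<sqsubseteq> y \<squnion> ?i" "v \<sqsubseteq> y \<squnion> ?i"
      using uv y by (simp_all add: diff_closed join_left join_right flip: diff_le_iff)
    then show "u \<squnion> v \<sqsubseteq> y \<squnion> ?i"
      using uv y by (simp add: diff_closed join_le)
  qed (use uv in simp)
  moreover have "x \<setminus> y \<in> I" if "x \<in> carrier L" "z \<in> carrier L" "z \<setminus> y \<in> I" "x \<sqsubseteq> z" for x z
    using that y by (meson diff_closed down join_closed le_join_diff le_trans)
  moreover have "\<bottom> \<setminus> y \<in> I"
    using I y by (auto simp: cbs_ideal_def intro!: down)
  ultimately show ?thesis
    by (auto simp: cbs_ideal_def ideal_adjoin_def)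
qed

lemma ideal_adjoin_superset:
  assumes "cbs_ideal L I" "y \<in> carrier L"
  shows "I \<subseteq> ideal_adjoin L I y"
  using assms unfolding ideal_adjoin_def
  by (auto simp: cbs_ideal_def) (meson diff_closed diff_le subsetD)

lemma mem_ideal_adjoin_self:
  assumes "cbs_ideal L I" "y \<in> carrier L"
  shows "y \<in> ideal_adjoin L I y"
  using assms by (simp add: ideal_adjoin_def diff_self cbs_ideal_def)

text \<open>\<open>ideal_adjoin L I y\<close> serves as \<open>J\<close> from left to right.
  Conversely, if \<open>x \<setminus> y\<close> were in \<open>J\<close>, then so would be
  \<open>x \<sqsubseteq> y \<squnion> (x \<setminus> y)\<close>. This is what makes the embedding
  respect differences.\<close>

lemma diff_notin_ideal_iff:
  assumes I: "cbs_ideal L I" and x: "x \<in> carrier L" and y: "y \<in> carrier L"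
  shows "x \<setminus> y \<notin> I \<longleftrightarrow> (\<exists>J. cbs_ideal L J \<and> I \<subseteq> J \<and> x \<notin> J \<and> y \<in> J)"
proof
  assume "x \<setminus> y \<notin> I"
  then have "x \<notin> ideal_adjoin L I y" by (simp add: ideal_adjoin_def)
  then show "\<exists>J. cbs_ideal L J \<and> I \<subseteq> J \<and> x \<notin> J \<and> y \<in> J"
    using I y cbs_ideal_adjoin ideal_adjoin_superset mem_ideal_adjoin_self by blast
next
  assume "\<exists>J. cbs_ideal L J \<and> I \<subseteq> J \<and> x \<notin> J \<and> y \<in> J"
  then obtain J where J: "cbs_ideal L J" "I \<subseteq> J" "x \<notin> J" "y \<in> J" by blast
  have "x \<in> J" if "x \<setminus> y \<in> J"
    using that J le_join_diff[OF x y] x by (auto simp: cbs_ideal_def)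
  then show "x \<setminus> y \<notin> I" using J by blast
qed

end


section \<open>The co-Brouwerian semilattice of down-closed sets\<close>

text \<open>For a preorder \<open>r\<close>, the down-closure of \<open>S - T\<close> is the least
  down-closed set whose union with \<open>T\<close> covers \<open>S\<close>.\<close>

definition downset_cbs :: "'p set \<Rightarrow> ('p \<Rightarrow> 'p \<Rightarrow> bool) \<Rightarrow> 'p set cbs"
  where "downset_cbs X r = \<lparr>carrier = {S. S \<subseteq> X \<and> (\<forall>x\<in>X. \<forall>y\<in>S. r x y \<longrightarrow> x \<in> S)},
    eq = (=), le = (\<subseteq>), diff = (\<lambda>S T. {x \<in> X. \<exists>y\<in>S - T. r x y})\<rparr>"

lemma downset_cbs_simps:
  "S \<in> carrier (downset_cbs X r) \<longleftrightarrow> S \<subseteq> X \<and> (\<forall>x\<in>X. \<forall>y\<in>S. r x y \<longrightarrow> x \<in> S)"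
  "S \<sqsubseteq>\<^bsub>downset_cbs X r\<^esub> T \<longleftrightarrow> S \<subseteq> T"
  "S \<setminus>\<^bsub>downset_cbs X r\<^esub> T = {x \<in> X. \<exists>y\<in>S - T. r x y}"
  by (simp_all add: downset_cbs_def)

lemma
  assumes refl: "\<And>x. x \<in> X \<Longrightarrow> r x x"
    and trans: "\<And>x y z. \<lbrakk>x \<in> X; y \<in> X; z \<in> X; r x y; r y z\<rbrakk> \<Longrightarrow> r x z"
  shows co_brouwerian_downset_cbs: "co_brouwerian_semilattice (downset_cbs X r)"
    and bottom_downset_cbs: "\<bottom>\<^bsub>downset_cbs X r\<^esub> = {}"
    and join_downset_cbs: "\<And>S T. \<lbrakk>S \<in> carrier (downset_cbs X r); T \<in> carrier (downset_cbs X r)\<rbrakk> \<Longrightarrow>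
      S \<squnion>\<^bsub>downset_cbs X r\<^esub> T = S \<union> T"
proof -
  let ?B = "downset_cbs X r"
  have eq: "eq ?B = (=)" by (simp add: downset_cbs_def)
  have diff_closed: "S \<setminus>\<^bsub>?B\<^esub> T \<in> carrier ?B"
    if "S \<in> carrier ?B" "T \<in> carrier ?B" for S T
    using that unfolding downset_cbs_simps by (blast intro: trans)
  have diff_le: "S \<setminus>\<^bsub>?B\<^esub> T \<sqsubseteq>\<^bsub>?B\<^esub> U \<longleftrightarrow> S \<sqsubseteq>\<^bsub>?B\<^esub> T \<union> U"
    if "S \<in> carrier ?B" "T \<in> carrier ?B" "U \<in> carrier ?B" for S T U
    using that unfolding downset_cbs_simps by (blast intro: refl)
  note ops = cbs_from_operations[of ?B "{}" "(\<union>)", OF eq _ _ _ _ _ _ _ diff_closed diff_le]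
  show "co_brouwerian_semilattice ?B"
    by (rule ops) (auto simp: downset_cbs_simps(1,2))
  show "\<bottom>\<^bsub>?B\<^esub> = {}"
    by (rule ops) (auto simp: downset_cbs_simps(1,2))
  show "S \<squnion>\<^bsub>?B\<^esub> T = S \<union> T" if "S \<in> carrier ?B" "T \<in> carrier ?B" for S T
    by (rule ops) (use that in \<open>auto simp: downset_cbs_simps(1,2)\<close>)
qed


section \<open>The extension by points below ideals\<close>

text \<open>The point \<open>(I, False)\<close> stands for the ideal \<open>I\<close>, and \<open>(I, True)\<close> for a new point below it.\<close>

definition ext_points :: "'a cbs \<Rightarrow> 'a set set \<Rightarrow> ('a set \<times> bool) set"
  where "ext_points L N = {(I, s). cbs_ideal L I \<and> (s \<longrightarrow> I \<in> N)}"

text \<open>Below \<open>(J, False)\<close> only inclusion counts, so ideals keep their inclusion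
  order and a new point lies below its own ideal. The clause for \<open>t\<close> also makes
  distinct new points incomparable.\<close>

definition ext_le :: "'a \<Rightarrow> 'a set \<times> bool \<Rightarrow> 'a set \<times> bool \<Rightarrow> bool"
  where "ext_le c = (\<lambda>(I, s) (J, t). I \<subseteq> J \<and> (t \<longrightarrow> (if s then I = J else c \<notin> I)))"

definition ext_cbs :: "'a cbs \<Rightarrow> 'a set set \<Rightarrow> 'a \<Rightarrow> ('a set \<times> bool) set cbs"
  where "ext_cbs L N c = downset_cbs (ext_points L N) (ext_le c)"

definition ext_emb :: "'a cbs \<Rightarrow> 'a set set \<Rightarrow> 'a \<Rightarrow> ('a set \<times> bool) set"
  where "ext_emb L N x = {(I, s) \<in> ext_points L N. x \<notin> I}"

lemma ext_le_simps [simp]: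
  "ext_le c (I, s) (J, False) \<longleftrightarrow> I \<subseteq> J"
  "ext_le c (I, False) (J, True) \<longleftrightarrow> I \<subseteq> J \<and> c \<notin> I"
  "ext_le c (I, True) (J, True) \<longleftrightarrow> I = J"
  by (auto simp: ext_le_def)

lemma ext_le_subset: "ext_le c (I, s) (J, t) \<Longrightarrow> I \<subseteq> J"
  by (simp add: ext_le_def)

lemma ext_le_refl: "ext_le c p p"
  by (cases p) (simp add: ext_le_def)

text \<open>The critical chain is new point, ideal, new point: the upper step requires the middle
  ideal to omit \<open>c\<close>, but it contains an ideal from \<open>N\<close>, hence
  \<open>c\<close>. So no such chain exists.\<close>

lemma ext_le_trans:
  assumes N: "\<forall>K\<in>N. c \<in> K"
    and "p \<in> ext_points L N" "ext_le c p q" "ext_le c q r"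
  shows "ext_le c p r"
  using assms by (auto simp: ext_points_def ext_le_def split: if_splits)

text \<open>\<open>cbs_embedding\<close> and \<open>\<lless>\<close> only apply to records without further fields.\<close>

locale plain_cbs = co_brouwerian_semilattice L for L :: "'a cbs" (structure)

context plain_cbs
begin

context
  fixes N :: "'a set set" and c :: 'a
  assumes N: "\<forall>K\<in>N. c \<in> K"
begin

lemma co_brouwerian_ext_cbs: "co_brouwerian_semilattice (ext_cbs L N c)"
  unfolding ext_cbs_def
  by (rule co_brouwerian_downset_cbs; metis ext_le_refl ext_le_trans[OF N])

lemma bottom_ext_cbs: "\<bottom>\<^bsub>ext_cbs L N c\<^esub> = {}"
  unfolding ext_cbs_def
  by (rule bottom_downset_cbs; metis ext_le_refl ext_le_trans[OF N])

lemma join_ext_cbs: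
  assumes "S \<in> carrier (ext_cbs L N c)" "T \<in> carrier (ext_cbs L N c)"
  shows "S \<squnion>\<^bsub>ext_cbs L N c\<^esub> T = S \<union> T"
  unfolding ext_cbs_def
  by (rule join_downset_cbs[OF _ _ assms[unfolded ext_cbs_def]]; metis ext_le_refl ext_le_trans[OF N])

lemma ext_emb_closed: "ext_emb L N x \<in> carrier (ext_cbs L N c)"
  unfolding ext_cbs_def downset_cbs_simps ext_emb_def
  by (auto dest!: ext_le_subset)

text \<open>New points do not disturb the difference: a witness \<open>J\<close> is used as the
  point \<open>(J, False)\<close>, which is above \<open>(I, s)\<close> for either flag. Conversely,
  \<open>ext_le\<close> always implies inclusion of the ideals.\<close>

lemma ext_emb_diff:
  assumes x: "x \<in> carrier L" and y: "y \<in> carrier L"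
  shows "ext_emb L N (x \<setminus> y) = ext_emb L N x \<setminus>\<^bsub>ext_cbs L N c\<^esub> ext_emb L N y"
proof -
  have "x \<setminus> y \<notin> I \<longleftrightarrow> (\<exists>q \<in> ext_emb L N x - ext_emb L N y. ext_le c (I, s) q)"
    if p: "(I, s) \<in> ext_points L N" for I s
  proof -
    have I: "cbs_ideal L I" using p by (simp add: ext_points_def)
    show ?thesis
    proof
      assume "x \<setminus> y \<notin> I"
      then obtain J where "cbs_ideal L J" "I \<subseteq> J" "x \<notin> J" "y \<in> J"
        using diff_notin_ideal_iff[OF I x y] by blast
      then have "(J, False) \<in> ext_emb L N x - ext_emb L N y" "ext_le c (I, s) (J, False)"
        by (auto simp: ext_emb_def ext_points_def)
      then show "\<exists>q \<in> ext_emb L N x - ext_emb L N y. ext_le c (I, s) q" by blast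
    next
      assume "\<exists>q \<in> ext_emb L N x - ext_emb L N y. ext_le c (I, s) q"
      then show "x \<setminus> y \<notin> I"
        unfolding diff_notin_ideal_iff[OF I x y]
        by (auto simp: ext_emb_def ext_points_def dest: ext_le_subset)
    qed
  qed
  then show ?thesis
    by (auto simp: ext_cbs_def downset_cbs_simps ext_emb_def[of L N "x \<setminus> y"])
qed

text \<open>The principal ideal of \<open>x\<close> omits \<open>y\<close> unless
  \<open>y \<sqsubseteq> x\<close>, and as a point it then separates the two images.\<close>

lemma inj_on_ext_emb: "inj_on (ext_emb L N) (carrier L)"
proof -
  have "y \<sqsubseteq> x" if eq: "ext_emb L N x = ext_emb L N y" and x: "x \<in> carrier L" "y \<in> carrier L" for x y
  proof (rule ccontr)
    assume "\<not> y \<sqsubseteq> x"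
    then have "({z \<in> carrier L. z \<sqsubseteq> x}, False) \<in> ext_emb L N y"
      using cbs_ideal_principal[OF x(1)] by (simp add: ext_emb_def ext_points_def)
    moreover have "({z \<in> carrier L. z \<sqsubseteq> x}, False) \<notin> ext_emb L N x"
      using x by (simp add: ext_emb_def)
    ultimately show False using eq by blast
  qed
  then show ?thesis by (intro inj_onI le_antisym) simp_all
qed

lemma cbs_embedding_ext_emb: "cbs_embedding L (ext_cbs L N c) (ext_emb L N)"
proof -
  have "ext_emb L N \<bottom> = {}"
    by (auto simp: ext_emb_def ext_points_def cbs_ideal_def)
  moreover have "ext_emb L N (x \<squnion> y) = ext_emb L N x \<union> ext_emb L N y"
    if "x \<in> carrier L" "y \<in> carrier L" for x y
    using that by (auto simp: ext_emb_def ext_points_def cbs_ideal_join_iff)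
  ultimately show ?thesis
    by (simp add: cbs_embedding_def ext_emb_closed inj_on_ext_emb ext_emb_diff bottom_ext_cbs join_ext_cbs)
qed

end

theorem density2_extension:
  fixes a\<^sub>1 a\<^sub>2 c d :: 'a
  assumes c: "c \<in> carrier L" and a: "a\<^sub>1 \<in> carrier L" "a\<^sub>2 \<in> carrier L" and d: "d \<in> carrier L"
    and nz: "a\<^sub>1 \<noteq> \<bottom>" "a\<^sub>2 \<noteq> \<bottom>" and ca: "c \<lless> a\<^sub>1" "c \<lless> a\<^sub>2" and da: "a\<^sub>1 \<setminus> d = a\<^sub>1" "a\<^sub>2 \<setminus> d = a\<^sub>2"
  obtains B :: "('a set \<times> bool) set cbs" and f b
  where "co_brouwerian_semilattice B" "cbs_embedding L B f" "b \<in> carrier B" "b \<noteq> \<bottom>\<^bsub>B\<^esub>"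
    "f c \<lless>\<^bsub>B\<^esub> b" "b \<lless>\<^bsub>B\<^esub> f a\<^sub>1" "b \<lless>\<^bsub>B\<^esub> f a\<^sub>2" "b \<setminus>\<^bsub>B\<^esub> f d = b"
proof -
  define N where "N = {K. cbs_ideal L K \<and> c \<in> K \<and> d \<in> K \<and> a\<^sub>1 \<notin> K \<and> a\<^sub>2 \<notin> K}"
  let ?B = "ext_cbs L N c" and ?f = "ext_emb L N"
  define b where "b = {(I, s) \<in> ext_points L N. s \<or> c \<notin> I}"
  have N: "\<forall>K\<in>N. c \<in> K" by (simp add: N_def)
  \<comment> \<open>Subtracting \<open>c \<squnion> d\<close> changes neither
    \<open>a\<^sub>1\<close> nor \<open>a\<^sub>2\<close>, so both stay outside the ideal when
    \<open>c \<squnion> d\<close> is adjoined.\<close>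
  have below: "\<exists>K\<in>N. I \<subseteq> K" if I: "cbs_ideal L I" "a\<^sub>1 \<notin> I" "a\<^sub>2 \<notin> I" for I
  proof
    let ?K = "ideal_adjoin L I (c \<squnion> d)"
    have K: "cbs_ideal L ?K" "c \<squnion> d \<in> ?K"
      using I c d by (simp_all add: cbs_ideal_adjoin mem_ideal_adjoin_self)
    have "a\<^sub>1 \<setminus> (c \<squnion> d) = a\<^sub>1" "a\<^sub>2 \<setminus> (c \<squnion> d) = a\<^sub>2"
      using ca da a c d by (simp_all add: diff_join_eqI well_below_def)
    then have "a\<^sub>1 \<notin> ?K" "a\<^sub>2 \<notin> ?K" using I by (simp_all add: ideal_adjoin_def)
    then show "?K \<in> N" using K c d by (simp add: N_def cbs_ideal_join_iff)
    show "I \<subseteq> ?K" using I c d by (simp add: ideal_adjoin_superset)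
  qed
  have ac: "a\<^sub>1 \<notin> I" "a\<^sub>2 \<notin> I" if "cbs_ideal L I" "c \<notin> I" for I
    using that ca c by (auto simp: well_below_def dest: cbs_ideal_downD)
  \<comment> \<open>Below a new point there are only that point itself and ideals omitting
    \<open>c\<close>; omitting \<open>c\<close> passes to smaller ideals.\<close>
  have b_closed: "b \<in> carrier ?B"
    by (auto simp: b_def ext_cbs_def downset_cbs_simps ext_le_def split: if_splits)
  \<comment> \<open>The new points are cofinal in \<open>b\<close>: an ideal omitting
    \<open>c\<close> omits \<open>a\<^sub>1\<close> and \<open>a\<^sub>2\<close>, so it extends to
    some \<open>K\<close> in \<open>N\<close>, and omitting \<open>c\<close> puts it below the new
    point of \<open>K\<close>.\<close>
  have b_new: "\<exists>K\<in>N. ext_le c p (K, True)" if "p \<in> b" for p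
    using that below ac by (cases p; cases "snd p") (fastforce simp: b_def ext_points_def)+
  have new: "(K, True) \<in> b - ?f c" "(K, True) \<in> b - ?f d" if "K \<in> N" for K
    using that by (auto simp: b_def ext_emb_def ext_points_def N_def)
  have b_sub: "b \<subseteq> ext_points L N" by (auto simp: b_def)
  \<comment> \<open>By cofinality, the down-closure of the new points is all of \<open>b\<close>.
    This covers subtraction of the images of both \<open>c\<close> and \<open>d\<close>.\<close>
  have diff_b: "b \<setminus>\<^bsub>?B\<^esub> S = b" if "\<And>K. K \<in> N \<Longrightarrow> (K, True) \<in> b - S" for S
    using b_closed that b_new b_sub unfolding ext_cbs_def downset_cbs_simps by blast
  have below_a: "b \<lless>\<^bsub>?B\<^esub> ?f x"
    if x: "x \<in> carrier L" "c \<lless> x" and Nx: "\<And>K. K \<in> N \<Longrightarrow> x \<notin> K" for x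
  proof -
    have "b \<subseteq> ?f x"
      using x Nx c by (auto simp: b_def ext_emb_def ext_points_def well_below_def dest: cbs_ideal_downD)
    \<comment> \<open>Since \<open>x \<setminus> c = x\<close>, the ideal \<open>I\<close> extends
      to some \<open>J\<close> that omits \<open>x\<close> but contains \<open>c\<close>. As an
      ideal containing \<open>c\<close>, \<open>(J, False)\<close> is outside
      \<open>b\<close>.\<close>
    moreover have "\<exists>q\<in>?f x - b. ext_le c (I, s) q" if p: "(I, s) \<in> ?f x" for I s
    proof -
      have I: "cbs_ideal L I" "x \<notin> I" using p by (auto simp: ext_emb_def ext_points_def)
      then have "x \<setminus> c \<notin> I" using x by (simp add: well_below_def)
      then obtain J where "cbs_ideal L J" "I \<subseteq> J" "x \<notin> J" "c \<in> J"
        using diff_notin_ideal_iff[OF I(1) x(1) c] by blast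
      then have "(J, False) \<in> ?f x - b" "ext_le c (I, s) (J, False)"
        by (auto simp: b_def ext_emb_def ext_points_def)
      then show ?thesis by blast
    qed
    then have "?f x \<setminus>\<^bsub>?B\<^esub> b = ?f x"
      using ext_emb_closed[OF N, of x] unfolding ext_cbs_def downset_cbs_simps by fast
    ultimately show ?thesis
      by (simp add: well_below_def ext_cbs_def downset_cbs_simps)
  qed
  \<comment> \<open>Applying \<open>below\<close> to the zero ideal shows that \<open>N\<close> is
    nonempty, hence that \<open>b\<close> is nonzero.\<close>
  have "cbs_ideal L {x \<in> carrier L. x \<sqsubseteq> \<bottom>}" by (simp add: cbs_ideal_principal)
  moreover have "\<not> a\<^sub>1 \<sqsubseteq> \<bottom>" "\<not> a\<^sub>2 \<sqsubseteq> \<bottom>"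
    using nz a by (meson bottom_closed bottom_lower le_antisym)+
  ultimately obtain K where "K \<in> N" using below by fastforce
  then have "b \<noteq> \<bottom>\<^bsub>?B\<^esub>" using new by (auto simp: bottom_ext_cbs[OF N])
  moreover have "?f c \<lless>\<^bsub>?B\<^esub> b"
    using diff_b[OF new(1)]
    by (auto simp: well_below_def ext_cbs_def downset_cbs_simps(2) b_def ext_emb_def)
  moreover have "b \<lless>\<^bsub>?B\<^esub> ?f a\<^sub>1" "b \<lless>\<^bsub>?B\<^esub> ?f a\<^sub>2"
    using below_a a ca by (auto simp: N_def)
  ultimately show ?thesis
    using that[OF co_brouwerian_ext_cbs[OF N] cbs_embedding_ext_emb[OF N] b_closed] diff_b[OF new(2)]
    by blast
qed

end


section \<open>The axiom as an existential sentence\<close>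

text \<open>The signature has no order symbol, so the inequality is expressed by an equation between
  joins.\<close>

definition well_below_fm :: "'a cbs_term \<Rightarrow> 'a cbs_term \<Rightarrow> 'a qf_formula"
  where "well_below_fm s t = Conj (Equal (Join s t) t) (Equal (Diff t s) t)"

lemma (in plain_cbs) qf_holds_well_below_fm:
  assumes "term_val L f v s \<in> carrier L" "term_val L f v t \<in> carrier L"
  shows "qf_holds L f v (well_below_fm s t) \<longleftrightarrow> term_val L f v s \<lless> term_val L f v t"
  using assms by (simp add: well_below_fm_def well_below_def join_eq_right_iff)

definition density2_fm :: "'a \<Rightarrow> 'a \<Rightarrow> 'a \<Rightarrow> 'a \<Rightarrow> 'a qf_formula"
  where "density2_fm c a\<^sub>1 a\<^sub>2 d =
    Conj (Neg (Equal (Var 0) Zero))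
    (Conj (well_below_fm (Param c) (Var 0))
    (Conj (well_below_fm (Var 0) (Param a\<^sub>1))
    (Conj (well_below_fm (Var 0) (Param a\<^sub>2))
      (Equal (Diff (Var 0) (Param d)) (Var 0)))))"

text \<open>The interpretation \<open>f\<close> of the parameters is left general because the
  sentence is read twice: in the extension through the embedding, and in the original semilattice
  through the identity.\<close>

lemma (in plain_cbs) ex_holds_density2_fm:
  assumes "f c \<in> carrier L" "f a\<^sub>1 \<in> carrier L" "f a\<^sub>2 \<in> carrier L"
  shows "ex_holds L f 1 (density2_fm c a\<^sub>1 a\<^sub>2 d) \<longleftrightarrow>
    (\<exists>b\<in>carrier L. b \<noteq> \<bottom> \<and> f c \<lless> b \<and> b \<lless> f a\<^sub>1 \<and> b \<lless> f a\<^sub>2 \<and> b \<setminus> f d = b)"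
proof -
  have "(\<forall>i<1. v i \<in> carrier L) \<and> qf_holds L f v (density2_fm c a\<^sub>1 a\<^sub>2 d) \<longleftrightarrow>
    v 0 \<in> carrier L \<and> v 0 \<noteq> \<bottom> \<and> f c \<lless> v 0 \<and> v 0 \<lless> f a\<^sub>1 \<and> v 0 \<lless> f a\<^sub>2 \<and> v 0 \<setminus> f d = v 0" for v
    using assms by (auto simp: density2_fm_def qf_holds_well_below_fm)
  \<comment> \<open>Only the value at \<open>0\<close> matters, and a constant assignment realizes
    any prescribed value.\<close>
  moreover have "(\<exists>v :: nat \<Rightarrow> 'a. P (v 0)) \<longleftrightarrow> (\<exists>b. P b)" for P
    by (auto intro: exI[of _ "\<lambda>_. b" for b])
  ultimately show ?thesis
    unfolding ex_holds_def Bex_def by simp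
qed

theorem theorem4p8:
  fixes L :: "'a cbs" (structure)
  assumes "existentially_closed L"
  shows "\<forall>c\<in>carrier L. \<forall>a\<^sub>1\<in>carrier L. \<forall>a\<^sub>2\<in>carrier L. \<forall>d\<in>carrier L.
    a\<^sub>1 \<noteq> \<bottom> \<and> a\<^sub>2 \<noteq> \<bottom> \<and> c \<lless> a\<^sub>1 \<and> c \<lless> a\<^sub>2 \<and> a\<^sub>1 \<setminus> d = a\<^sub>1 \<and> a\<^sub>2 \<setminus> d = a\<^sub>2 \<longrightarrow>
    (\<exists>b\<in>carrier L. b \<noteq> \<bottom> \<and> c \<lless> b \<and> b \<lless> a\<^sub>1 \<and> b \<lless> a\<^sub>2 \<and> b \<setminus> d = b)"
proof (intro ballI impI; (elim conjE)?)
  interpret L: plain_cbs L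
    using assms by (simp add: existentially_closed_def plain_cbs_def)
  fix c a\<^sub>1 a\<^sub>2 d
  assume mem: "c \<in> carrier L" "a\<^sub>1 \<in> carrier L" "a\<^sub>2 \<in> carrier L" "d \<in> carrier L"
    and hyps: "a\<^sub>1 \<noteq> \<bottom>" "a\<^sub>2 \<noteq> \<bottom>" "c \<lless> a\<^sub>1" "c \<lless> a\<^sub>2" "a\<^sub>1 \<setminus> d = a\<^sub>1" "a\<^sub>2 \<setminus> d = a\<^sub>2"
  obtain B :: "('a set \<times> bool) set cbs" and f b where B: "co_brouwerian_semilattice B"
    and f: "cbs_embedding L B f"
    and b: "b \<in> carrier B" "b \<noteq> \<bottom>\<^bsub>B\<^esub>" "f c \<lless>\<^bsub>B\<^esub> b" "b \<lless>\<^bsub>B\<^esub> f a\<^sub>1" "b \<lless>\<^bsub>B\<^esub> f a\<^sub>2" "b \<setminus>\<^bsub>B\<^esub> f d = b"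
    using L.density2_extension[OF mem hyps] .
  have "f x \<in> carrier B" if "x \<in> carrier L" for x
    using f that by (auto simp: cbs_embedding_def)
  then have "ex_holds B f 1 (density2_fm c a\<^sub>1 a\<^sub>2 d)"
    using b mem by (subst plain_cbs.ex_holds_density2_fm[OF plain_cbs.intro[OF B]]) auto
  moreover have "qf_vars (density2_fm c a\<^sub>1 a\<^sub>2 d) \<subseteq> {..<1}"
    "qf_params (density2_fm c a\<^sub>1 a\<^sub>2 d) \<subseteq> carrier L"
    using mem by (auto simp: density2_fm_def well_below_fm_def)
  \<comment> \<open>The elements of \<open>B\<close> are sets of points rather than terms, so the
    sentence is pulled back by the version of existential closedness for superstructures over
    arbitrary types.\<close>
  ultimately have "ex_holds L (\<lambda>a. a) 1 (density2_fm c a\<^sub>1 a\<^sub>2 d)"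
    using existentially_closed_superstructure[OF assms B f] by blast
  then show "\<exists>b\<in>carrier L. b \<noteq> \<bottom> \<and> c \<lless> b \<and> b \<lless> a\<^sub>1 \<and> b \<lless> a\<^sub>2 \<and> b \<setminus> d = b"
    using mem by (subst (asm) L.ex_holds_density2_fm) auto
qed

end
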